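(* Let $B$ be a finite two-sided skew brace. Then the following conditions are equivalent: (1) $B$ is perfect (as a skew brace); (2) the additive group $(B,+)$ is perfect; (3) the multiplicative group $(B,\cdot)$ is perfect.
   Context: A skew brace is a triple $(B,+,\cdot)$ such that $(B,+)$ and $(B,\cdot)$ are groups (neither assumed abelian) and $a\cdot(b+c)=a\cdot b-a+a\cdot c$ for all $a,b,c\in B$; both groups have the same identity, denoted $0$. It is two-sided if moreover $(a+b)c=ac-c+bc$ for all $a,b,c\in B$. For $b\in B$ put $\lambda_b(a)=-b+ba$. A subset $I\subseteq B$ is an ideal if $(I,+)\trianglelefteq(B,+)$, $(I,\cdot)\trianglelefteq(B,\cdot)$ and $\lambda_b(I)\subseteq I$ for all $b\in B$. The commutator ideal $[B,B]^B$ is the ideal of $B$ generated by the additive commutators, the multiplicative commutators and the elements $ab-(a+b)$, $a,b\in B$. The skew brace $B$ is perfect if $B=[B,B]^B$. A group is perfect if it equals its derived subgroup. *)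

theory Defs
  imports "HOL-Algebra.Algebra"
begin

text \<open>
  A skew brace is carried by the record type of rings: addition lives in \<^term>\<open>add_monoid B\<close>, while
  \<^term>\<open>B\<close> itself, read as a monoid record, is the multiplicative structure. Neither group is assumed abelian.
  The additive inverse is \<^term>\<open>a_inv B\<close>, which is by definition the inverse in
  \<^term>\<open>add_monoid B\<close>. That the two identities coincide is a consequence of the axioms, see
  \<open>one_eq_zero\<close> below.
\<close>

locale skew_brace = additive: group "add_monoid B" + group B for B (structure) +
  assumes left_brace: "\<lbrakk>a \<in> carrier B; b \<in> carrier B; c \<in> carrier B\<rbrakk>
    \<Longrightarrow> a \<otimes> (b \<oplus> c) = a \<otimes> b \<oplus> (\<ominus> a) \<oplus> a \<otimes> c"

locale two_sided_skew_brace = skew_brace +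
  assumes right_brace: "\<lbrakk>a \<in> carrier B; b \<in> carrier B; c \<in> carrier B\<rbrakk>
    \<Longrightarrow> (a \<oplus> b) \<otimes> c = a \<otimes> c \<oplus> (\<ominus> c) \<oplus> b \<otimes> c"

definition brace_lambda :: "('a, 'b) ring_scheme \<Rightarrow> 'a \<Rightarrow> 'a \<Rightarrow> 'a"
  where "brace_lambda B b a = (\<ominus>\<^bsub>B\<^esub> b) \<oplus>\<^bsub>B\<^esub> (b \<otimes>\<^bsub>B\<^esub> a)"

definition brace_ideal :: "'a set \<Rightarrow> ('a, 'b) ring_scheme \<Rightarrow> bool"
  where "brace_ideal I B \<longleftrightarrow>
    I \<lhd> add_monoid B \<and> I \<lhd> B \<and> (\<forall>b \<in> carrier B. brace_lambda B b ` I \<subseteq> I)"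

definition gen_brace_ideal :: "('a, 'b) ring_scheme \<Rightarrow> 'a set \<Rightarrow> 'a set"
  where "gen_brace_ideal B S = \<Inter> {I. brace_ideal I B \<and> S \<subseteq> I}"

text \<open>
  The sets \<open>derived_set G H\<close> consist of the commutators \<open>x y x\<^sup>-\<^sup>1 y\<^sup>-\<^sup>1\<close> with \<open>x\<close>, \<open>y\<close> in \<open>H\<close>.
\<close>

definition commutator_brace_ideal :: "('a, 'b) ring_scheme \<Rightarrow> 'a set"
  where "commutator_brace_ideal B = gen_brace_ideal B
    (derived_set (add_monoid B) (carrier B) \<union>
     derived_set B (carrier B) \<union>
     {a \<otimes>\<^bsub>B\<^esub> b \<oplus>\<^bsub>B\<^esub> (\<ominus>\<^bsub>B\<^esub> (a \<oplus>\<^bsub>B\<^esub> b)) | a b. a \<in> carrier B \<and> b \<in> carrier B})"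

definition perfect_brace :: "('a, 'b) ring_scheme \<Rightarrow> bool"
  where "perfect_brace B \<longleftrightarrow> carrier B = commutator_brace_ideal B"

definition perfect_group :: "('a, 'b) monoid_scheme \<Rightarrow> bool"
  where "perfect_group G \<longleftrightarrow> carrier G = derived G (carrier G)"

context skew_brace
begin

lemma one_eq_zero: "\<one> = \<zero>"
proof -
  have z: "\<zero> \<in> carrier B" using additive.one_closed by simp
  have "\<one> \<otimes> (\<zero> \<oplus> \<zero>) = \<one> \<otimes> \<zero> \<oplus> (\<ominus> \<one>) \<oplus> \<one> \<otimes> \<zero>"
    using z by (intro left_brace) auto
  moreover have "\<zero> \<oplus> \<zero> = \<zero>" using additive.l_one[of \<zero>] z by simp
  moreover have m: "\<ominus> \<one> \<in> carrier B" using additive.inv_closed[of \<one>] by (simp add: a_inv_def)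
  ultimately have "\<zero> = \<ominus> \<one>"
    using z additive.l_one[of "\<ominus> \<one>"] additive.r_one[of "\<ominus> \<one>"] by simp
  then have "\<zero> = \<one> \<oplus> \<zero>" using additive.r_inv[of \<one>] by (simp add: a_inv_def)
  then show ?thesis using additive.r_one[of \<one>] by simp
qed

lemma brace_ideal_carrier: "brace_ideal (carrier B) B"
proof -
  have "carrier B \<lhd> add_monoid B" using additive.normal_self by simp
  moreover have "\<ominus> b \<in> carrier B" if "b \<in> carrier B" for b
    using additive.inv_closed[of b] that by (simp add: a_inv_def)
  then have "brace_lambda B b a \<in> carrier B" if "b \<in> carrier B" "a \<in> carrier B" for a b
    using additive.m_closed[of "\<ominus> b" "b \<otimes> a"] that by (simp add: brace_lambda_def)
  ultimately show ?thesis using normal_self by (auto simp: brace_ideal_def)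
qed

lemma brace_ideal_gen:
  assumes "S \<subseteq> carrier B"
  shows "brace_ideal (gen_brace_ideal B S) B"
proof -
  let ?F = "{I. brace_ideal I B \<and> S \<subseteq> I}"
  have ne: "?F \<noteq> {}" using brace_ideal_carrier assms by blast
  have "subgroup (\<Inter> ?F) (add_monoid B)"
    using ne by (intro additive.subgroups_Inter) (auto simp: brace_ideal_def normal_imp_subgroup)
  then have "\<Inter> ?F \<lhd> add_monoid B"
    by (auto simp: additive.normal_inv_iff brace_ideal_def)
  moreover have "subgroup (\<Inter> ?F) B"
    using ne by (intro subgroups_Inter) (auto simp: brace_ideal_def normal_imp_subgroup)
  then have "\<Inter> ?F \<lhd> B"
    by (auto simp: normal_inv_iff brace_ideal_def)
  ultimately show ?thesis
    unfolding gen_brace_ideal_def by (auto simp: brace_ideal_def)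
qed

end

end

theory Submission
  imports Defs
begin

text \<open>
  Write \<open>a * b = - a + a b - b\<close> and \<open>a *' b = - b + a b - a\<close>; the second is the star operation of
  the opposite skew brace. Expanding \<open>(a + b) (c + d)\<close> in two ways shows that every \<open>a * d\<close> commutes
  additively with every \<open>b *' c\<close>.

  Let \<open>(B,+)\<close> be perfect, \<open>C\<close> the additive centralizer of all \<open>a * b\<close> and \<open>N\<close> the centralizer of \<open>C\<close>.
  Modulo \<open>N + C\<close> one has \<open>a b = a + b = b + a\<close>, so \<open>B = N + C\<close> is a central product. On an additively
  central \<open>z\<close> the map \<open>a \<mapsto> a * z\<close> is a homomorphism into an abelian group, hence trivial; from this
  and perfectness \<open>b c = b + c\<close> for \<open>c\<close> in \<open>C\<close>, and dually \<open>b n = n + b\<close> for \<open>n\<close> in \<open>N\<close>. Consequently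
  the abelianization map of \<open>(B,\<cdot>)\<close> is also additive, and therefore trivial.

  Now let \<open>B\<close> be finite and perfect as a skew brace, and suppose that \<open>(B,+)\<close> is not perfect. Choose a
  maximal proper \<open>\<lambda>\<close>-invariant additive subgroup \<open>M\<close> containing the additive commutators. As in
  Nakayama's lemma, maximality forces \<open>b * x\<close> to lie in \<open>M\<close> for all \<open>b\<close> and \<open>x\<close>, so \<open>M\<close> is an ideal
  containing the commutator ideal, a contradiction.
\<close>

section \<open>Perfect groups\<close>

context group
begin

text \<open>Perfectness is applied in this form: a property that defines a subgroup and holds for
  all commutators holds everywhere.\<close>

lemma perfect_group_subset:
  assumes "perfect_group G" "subgroup K G"
    and "\<And>x y. \<lbrakk>x \<in> carrier G; y \<in> carrier G\<rbrakk> \<Longrightarrow> x \<otimes> y \<otimes> inv x \<otimes> inv y \<in> K"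
  shows "carrier G \<subseteq> K"
proof -
  have "derived G (carrier G) \<subseteq> K"
    unfolding derived_def using assms by (intro generate_subgroup_incl) auto
  then show ?thesis using assms(1) by (simp add: perfect_group_def)
qed

lemma subgroup_eq_one:
  assumes "f \<in> hom G H" "group H"
  shows "subgroup {x \<in> carrier G. f x = \<one>\<^bsub>H\<^esub>} G"
proof -
  interpret f: group_hom G H f
    using assms group_axioms by (simp add: group_hom_def group_hom_axioms_def)
  show ?thesis using f.subgroup_kernel by (simp add: kernel_def)
qed

lemma hom_commutator_trivial:
  assumes "f \<in> hom G H" "group H" "x \<in> carrier G" "y \<in> carrier G"
    and "f x \<otimes>\<^bsub>H\<^esub> f y = f y \<otimes>\<^bsub>H\<^esub> f x"
  shows "f (x \<otimes> y \<otimes> inv x \<otimes> inv y) = \<one>\<^bsub>H\<^esub>"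
proof -
  interpret f: group_hom G H f
    using assms group_axioms by (simp add: group_hom_def group_hom_axioms_def)
  have "f (x \<otimes> y \<otimes> inv x \<otimes> inv y) = f y \<otimes>\<^bsub>H\<^esub> f x \<otimes>\<^bsub>H\<^esub> inv\<^bsub>H\<^esub> f x \<otimes>\<^bsub>H\<^esub> inv\<^bsub>H\<^esub> f y"
    using assms by simp
  then show ?thesis using assms by (simp add: f.H.m_assoc)
qed

text \<open>Commuting values are required rather than an abelian \<open>H\<close>, so that
  \<open>H\<close> may be the possibly nonabelian group \<open>add_monoid B\<close> when the values
  are central.\<close>

lemma perfect_hom_trivial:
  assumes "perfect_group G" "f \<in> hom G H" "group H"
    and "\<And>x y. \<lbrakk>x \<in> carrier G; y \<in> carrier G\<rbrakk> \<Longrightarrow> f x \<otimes>\<^bsub>H\<^esub> f y = f y \<otimes>\<^bsub>H\<^esub> f x"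
    and "x \<in> carrier G"
  shows "f x = \<one>\<^bsub>H\<^esub>"
  using perfect_group_subset[OF assms(1) subgroup_eq_one[OF assms(2,3)]]
    hom_commutator_trivial[OF assms(2,3)] assms(4,5)
  by auto

text \<open>Packages the quotient by \<open>M\<close> as a homomorphism \<open>p\<close> with kernel
  \<open>M\<close>, so that later congruences modulo \<open>M\<close> become equations in an abelian
  group.\<close>

lemma abelian_quotient:
  assumes "subgroup M G"
    and "\<And>x y. \<lbrakk>x \<in> carrier G; y \<in> carrier G\<rbrakk> \<Longrightarrow> x \<otimes> y \<otimes> inv x \<otimes> inv y \<in> M"
  obtains Q :: "'a set monoid" and p
  where "M \<lhd> G" "comm_group Q" "p \<in> hom G Q" "\<And>x. x \<in> carrier G \<Longrightarrow> p x = \<one>\<^bsub>Q\<^esub> \<longleftrightarrow> x \<in> M"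
proof
  interpret M: subgroup M G by (rule assms(1))
  show n: "M \<lhd> G"
    unfolding normal_inv_iff
  proof (intro conjI ballI assms(1))
    fix x h assume h: "x \<in> carrier G" "h \<in> M"
    \<comment> \<open>The conjugate of \<open>h\<close> by \<open>x\<close> is the commutator of
      \<open>x\<close> and \<open>h\<close> times \<open>h\<close>.\<close>
    then have "x \<otimes> h \<otimes> inv x \<otimes> inv h \<otimes> h \<in> M"
      using assms(2)[of x h] M.mem_carrier[of h] M.m_closed by simp
    then show "x \<otimes> h \<otimes> inv x \<in> M" using h by (simp add: m_assoc)
  qed
  interpret M: normal M G by (rule n)
  show "comm_group (G Mod M)"
  proof (rule group.group_comm_groupI[OF M.factorgroup_is_group])
    fix U V assume "U \<in> carrier (G Mod M)" "V \<in> carrier (G Mod M)"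
    then obtain x y where xy: "x \<in> carrier G" "y \<in> carrier G" "U = M #> x" "V = M #> y"
      by (auto simp: FactGroup_def RCOSETS_def)
    have "x \<otimes> y \<otimes> inv (y \<otimes> x) \<in> M"
      using assms(2)[OF xy(1,2)] xy by (simp add: inv_mult_group m_assoc)
    then have "M #> (x \<otimes> y) = M #> (y \<otimes> x)"
      using xy coset_join2[OF _ assms(1)] coset_mult_assoc[of M "x \<otimes> y \<otimes> inv (y \<otimes> x)" "y \<otimes> x"]
        M.subset by (simp add: m_assoc)
    then show "U \<otimes>\<^bsub>G Mod M\<^esub> V = V \<otimes>\<^bsub>G Mod M\<^esub> U"
      using xy by (simp add: FactGroup_def M.rcos_sum)
  qed
  show "(\<lambda>x. M #> x) \<in> hom G (G Mod M)" by (rule M.r_coset_hom_Mod)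
  show "M #> x = \<one>\<^bsub>G Mod M\<^esub> \<longleftrightarrow> x \<in> M" if "x \<in> carrier G" for x
    using that coset_join1[OF _ _ assms(1)] coset_join2[OF _ assms(1)] by auto
qed

section \<open>Centralizers and central products\<close>

definition centralizer :: "'a set \<Rightarrow> 'a set"
  where "centralizer S = {x \<in> carrier G. \<forall>s \<in> S. x \<otimes> s = s \<otimes> x}"

lemma subgroup_centralizer:
  assumes "S \<subseteq> carrier G"
  shows "subgroup (centralizer S) G"
proof (rule subgroupI)
  fix x assume x: "x \<in> centralizer S"
  have "inv x \<otimes> s = s \<otimes> inv x" if "s \<in> S" for s
  proof -
    have s: "s \<in> carrier G" "x \<in> carrier G" "x \<otimes> s = s \<otimes> x"
      using x that assms by (auto simp: centralizer_def)
    have "inv x \<otimes> s = inv x \<otimes> (s \<otimes> x) \<otimes> inv x" using s(1,2) by (simp add: m_assoc)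
    also have "\<dots> = s \<otimes> inv x"
      unfolding s(3)[symmetric] using s(1,2) by (simp flip: m_assoc)
    finally show ?thesis .
  qed
  then show "inv x \<in> centralizer S" using x by (simp add: centralizer_def)
next
  fix x y assume x: "x \<in> centralizer S" "y \<in> centralizer S"
  have "x \<otimes> y \<otimes> s = s \<otimes> (x \<otimes> y)" if "s \<in> S" for s
  proof -
    have s: "s \<in> carrier G" "x \<in> carrier G" "x \<otimes> s = s \<otimes> x" "y \<in> carrier G" "y \<otimes> s = s \<otimes> y"
      using x that assms by (auto simp: centralizer_def)
    have "x \<otimes> y \<otimes> s = x \<otimes> (y \<otimes> s)" using s(1,2,4) by (simp add: m_assoc)
    also have "\<dots> = (x \<otimes> s) \<otimes> y" unfolding s(5) using s(1,2,4) by (simp add: m_assoc)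
    also have "\<dots> = s \<otimes> (x \<otimes> y)" unfolding s(3) using s(1,2,4) by (simp add: m_assoc)
    finally show ?thesis .
  qed
  then show "x \<otimes> y \<in> centralizer S" using x by (simp add: centralizer_def)
next
  have "\<one> \<in> centralizer S" using assms by (auto simp: centralizer_def)
  then show "centralizer S \<noteq> {}" by blast
qed (auto simp: centralizer_def)

text \<open>The conjugate of \<open>c\<close> by \<open>g\<close> commutes with \<open>s\<close> as
  soon as \<open>c\<close> commutes with \<open>inv g \<otimes> s \<otimes> g\<close>. Placing the
  latter in the double centralizer suffices, so \<open>S\<close> itself may fail to be stable under
  conjugation.\<close>

lemma centralizer_conj:
  assumes "S \<subseteq> carrier G" "g \<in> carrier G"
    and "\<And>s. s \<in> S \<Longrightarrow> inv g \<otimes> s \<otimes> g \<in> centralizer (centralizer S)"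
    and "c \<in> centralizer S"
  shows "g \<otimes> c \<otimes> inv g \<in> centralizer S"
proof -
  have "g \<otimes> c \<otimes> inv g \<otimes> s = s \<otimes> (g \<otimes> c \<otimes> inv g)" if "s \<in> S" for s
  proof -
    have s: "s \<in> carrier G" "c \<in> carrier G" and
      e: "(inv g \<otimes> s \<otimes> g) \<otimes> c = c \<otimes> (inv g \<otimes> s \<otimes> g)"
      using assms that by (auto simp: centralizer_def)
    have "s \<otimes> (g \<otimes> c \<otimes> inv g) = g \<otimes> ((inv g \<otimes> s \<otimes> g) \<otimes> c) \<otimes> inv g"
      using s assms(2) by (simp add: m_assoc) (simp flip: m_assoc)
    also have "\<dots> = g \<otimes> c \<otimes> inv g \<otimes> s"
      unfolding e using s assms(2) by (simp add: m_assoc)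
    finally show ?thesis by simp
  qed
  then show ?thesis using assms by (simp add: centralizer_def)
qed

text \<open>The commutator \<open>Q\<close> of \<open>c\<close> and \<open>d\<close> centralizes
  \<open>n\<close> and \<open>m\<close> because \<open>c\<close> and \<open>d\<close> do, so it can
  be moved past \<open>inv n\<close> and \<open>inv m\<close>.\<close>

lemma commutator_mult:
  assumes "n \<in> carrier G" "m \<in> carrier G" "c \<in> carrier G" "d \<in> carrier G"
    and "c \<otimes> n = n \<otimes> c" "c \<otimes> m = m \<otimes> c" "d \<otimes> n = n \<otimes> d" "d \<otimes> m = m \<otimes> d"
  shows "(n \<otimes> c) \<otimes> (m \<otimes> d) \<otimes> inv (n \<otimes> c) \<otimes> inv (m \<otimes> d) =
    (n \<otimes> m \<otimes> inv n \<otimes> inv m) \<otimes> (c \<otimes> d \<otimes> inv c \<otimes> inv d)"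
proof -
  define Q where "Q = c \<otimes> d \<otimes> inv c \<otimes> inv d"
  have Q: "Q \<in> carrier G" using assms by (simp add: Q_def)
  have C: "subgroup (centralizer {n, m}) G" and D: "subgroup (centralizer {Q}) G"
    using assms(1,2) Q by (auto intro: subgroup_centralizer)
  have "c \<in> centralizer {n, m}" "d \<in> centralizer {n, m}"
    using assms by (simp_all add: centralizer_def)
  then have "Q \<in> centralizer {n, m}"
    unfolding Q_def by (intro subgroup.m_closed[OF C] subgroup.m_inv_closed[OF C])
  then have "n \<in> centralizer {Q}" "m \<in> centralizer {Q}"
    using assms(1,2) by (simp_all add: centralizer_def)
  then have "inv n \<otimes> inv m \<in> centralizer {Q}"
    by (intro subgroup.m_closed[OF D] subgroup.m_inv_closed[OF D])
  then have eq: "(inv n \<otimes> inv m) \<otimes> Q = Q \<otimes> (inv n \<otimes> inv m)"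
    by (simp add: centralizer_def)
  have "(n \<otimes> c) \<otimes> (m \<otimes> d) \<otimes> inv (n \<otimes> c) \<otimes> inv (m \<otimes> d) =
    n \<otimes> (c \<otimes> m) \<otimes> d \<otimes> inv c \<otimes> inv (d \<otimes> n) \<otimes> inv m"
    using assms(1-4) by (simp add: m_assoc inv_mult_group)
  also have "\<dots> = (n \<otimes> m) \<otimes> (Q \<otimes> (inv n \<otimes> inv m))"
    unfolding assms(6,7) Q_def using assms(1-4) by (simp add: m_assoc inv_mult_group)
  also have "\<dots> = (n \<otimes> m \<otimes> inv n \<otimes> inv m) \<otimes> Q"
    unfolding eq[symmetric] using assms(1,2) Q by (simp add: m_assoc)
  finally show ?thesis unfolding Q_def .
qed

text \<open>Tailored to \<open>f = lam b\<close>, with \<open>N\<close> and \<open>C\<close> the two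
  centralizers built from the stars. Elements of \<open>N \<inter> C\<close> are central in the
  product; perfectness turns "\<open>f\<close> moves \<open>C\<close> by central factors" into
  "\<open>f\<close> fixes \<open>C\<close>".\<close>

lemma perfect_central_product_hom:
  assumes "perfect_group G" "subgroup N G" "subgroup C G" "f \<in> hom G G"
    and comm: "\<And>n c. \<lbrakk>n \<in> N; c \<in> C\<rbrakk> \<Longrightarrow> c \<otimes> n = n \<otimes> c"
    and prod: "carrier G \<subseteq> N <#> C"
    and f: "\<And>c. c \<in> C \<Longrightarrow> f c \<otimes> inv c \<in> N \<inter> C"
    and fixed: "\<And>z. z \<in> N \<inter> C \<Longrightarrow> f z = z"
    and c: "c \<in> C"
  shows "f c = c"
proof -
  interpret N: subgroup N G by fact
  interpret C: subgroup C G by fact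
  interpret f: group_hom G G f
    using assms group_axioms by (simp add: group_hom_def group_hom_axioms_def)
  have comm': "c \<otimes> (n \<otimes> x) = n \<otimes> (c \<otimes> x)" if "n \<in> N" "c \<in> C" "x \<in> carrier G" for n c x
    using that comm[of n c] by (simp flip: m_assoc)
  \<comment> \<open>Since \<open>f\<close> moves elements of \<open>C\<close> only by central factors, it fixes their commutators,
      so \<open>K\<close> contains all commutators of \<open>G\<close>.\<close>
  define K where "K = {n \<otimes> c | n c. n \<in> N \<and> c \<in> C \<and> f c = c}"
  have "subgroup K G"
  proof (rule subgroupI)
    have "\<one> \<otimes> \<one> \<in> K" unfolding K_def
      by (intro CollectI exI[of _ \<one>]) simp
    then show "K \<noteq> {}" by blast
  next
    fix a assume "a \<in> K"
    then obtain n c where *: "n \<in> N" "c \<in> C" "f c = c" "a = n \<otimes> c" unfolding K_def by blast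
    then have "inv a = inv n \<otimes> inv c"
      using comm[of "inv n" "inv c"] by (simp add: inv_mult_group)
    with * show "inv a \<in> K" unfolding K_def
      by (intro CollectI exI[of _ "inv n"] exI[of _ "inv c"]) simp
  next
    fix a b assume "a \<in> K" "b \<in> K"
    then obtain n c m d where *: "n \<in> N" "c \<in> C" "f c = c" "a = n \<otimes> c"
      "m \<in> N" "d \<in> C" "f d = d" "b = m \<otimes> d" unfolding K_def by blast
    then have "a \<otimes> b = (n \<otimes> m) \<otimes> (c \<otimes> d)"
      using comm'[of m c d] by (simp add: m_assoc)
    with * show "a \<otimes> b \<in> K" unfolding K_def
      by (intro CollectI exI[of _ "n \<otimes> m"] exI[of _ "c \<otimes> d"]) simp
  next
    have "N <#> C \<subseteq> carrier G" using N.subset C.subset by (rule set_mult_closed)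
    then show "K \<subseteq> carrier G" unfolding K_def set_mult_def by blast
  qed
  moreover have "x \<otimes> y \<otimes> inv x \<otimes> inv y \<in> K" if "x \<in> carrier G" "y \<in> carrier G" for x y
  proof -
    have "x \<in> N <#> C" "y \<in> N <#> C" using prod that by auto
    then obtain n c m d where *: "n \<in> N" "c \<in> C" "x = n \<otimes> c" "m \<in> N" "d \<in> C" "y = m \<otimes> d"
      unfolding set_mult_def by auto
    define z where "z = f c \<otimes> inv c"
    define w where "w = f d \<otimes> inv d"
    have z: "z \<in> N" "z \<in> C" "w \<in> N" "w \<in> C" using f * by (auto simp: z_def w_def)
    have fc: "f c = z \<otimes> c" "f d = w \<otimes> d" using * by (simp_all add: z_def w_def m_assoc)
    have zc: "c \<otimes> z = z \<otimes> c" "d \<otimes> z = z \<otimes> d" "c \<otimes> w = w \<otimes> c" "d \<otimes> w = w \<otimes> d" "z \<otimes> w = w \<otimes> z"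
      using * z comm by auto
    define P where "P = n \<otimes> m \<otimes> inv n \<otimes> inv m"
    define Q where "Q = c \<otimes> d \<otimes> inv c \<otimes> inv d"
    have "f Q = (z \<otimes> c) \<otimes> (w \<otimes> d) \<otimes> inv (z \<otimes> c) \<otimes> inv (w \<otimes> d)"
      unfolding Q_def using * z by (simp add: fc)
    also have "\<dots> = (z \<otimes> w \<otimes> inv z \<otimes> inv w) \<otimes> Q"
      unfolding Q_def using * z zc by (intro commutator_mult) auto
    also have "z \<otimes> w \<otimes> inv z \<otimes> inv w = \<one>"
      unfolding zc(5) using z by (simp add: m_assoc)
    finally have fQ: "f Q = Q" using * by (simp add: Q_def)
    have "x \<otimes> y \<otimes> inv x \<otimes> inv y = P \<otimes> Q"
      unfolding P_def Q_def *(3,6)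
      by (rule commutator_mult) (use *(1,2,4,5) in \<open>auto intro: comm\<close>)
    moreover have "P \<in> N" "Q \<in> C" unfolding P_def Q_def using * by auto
    ultimately show ?thesis unfolding K_def
      by (intro CollectI exI[of _ P] exI[of _ Q]) (simp add: fQ)
  qed
  ultimately have "carrier G \<subseteq> K" using perfect_group_subset assms(1) by blast
  then have "c \<in> K" using c by auto
  then obtain n d where *: "n \<in> N" "d \<in> C" "f d = d" "c = n \<otimes> d"
    unfolding K_def by auto
  \<comment> \<open>The \<open>N\<close>-component \<open>n\<close> of \<open>c\<close> equals
    \<open>c \<otimes> inv d\<close>, so it also lies in \<open>C\<close>, and \<open>fixed\<close>
    applies to it.\<close>
  have "c \<otimes> inv d \<in> C" using *(2) c by blast
  then have "n \<in> N \<inter> C" using *(1,2) by (simp add: *(4) m_assoc)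
  then have "f n = n" by (rule fixed)
  then show ?thesis unfolding *(4) using *(1-3) by simp
qed

lemma normal_centralizer:
  assumes "S \<subseteq> carrier G"
    and "\<And>g s. \<lbrakk>g \<in> carrier G; s \<in> S\<rbrakk> \<Longrightarrow> inv g \<otimes> s \<otimes> g \<in> centralizer (centralizer S)"
  shows "centralizer S \<lhd> G"
  unfolding normal_inv_iff
  using subgroup_centralizer[OF assms(1)] centralizer_conj[OF assms(1) _ assms(2)] by blast

lemma subset_double_centralizer:
  "S \<subseteq> carrier G \<Longrightarrow> S \<subseteq> centralizer (centralizer S)"
  by (auto simp: centralizer_def)

end

section \<open>Skew braces\<close>

context skew_brace
begin

section \<open>Arithmetic in the additive group\<close>

lemma add_closed [simp]: "\<lbrakk>a \<in> carrier B; b \<in> carrier B\<rbrakk> \<Longrightarrow> a \<oplus> b \<in> carrier B"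
  using additive.m_closed by simp

lemma zero_closed [simp]: "\<zero> \<in> carrier B"
  using additive.one_closed by simp

lemma neg_closed [simp]: "a \<in> carrier B \<Longrightarrow> \<ominus> a \<in> carrier B"
  using additive.inv_closed by (simp add: a_inv_def)

lemma add_assoc: "\<lbrakk>a \<in> carrier B; b \<in> carrier B; c \<in> carrier B\<rbrakk> \<Longrightarrow> a \<oplus> b \<oplus> c = a \<oplus> (b \<oplus> c)"
  using additive.m_assoc by simp

lemma zero_add [simp]: "a \<in> carrier B \<Longrightarrow> \<zero> \<oplus> a = a"
  using additive.l_one by simp

lemma add_zero [simp]: "a \<in> carrier B \<Longrightarrow> a \<oplus> \<zero> = a"
  using additive.r_one by simp

lemma neg_add [simp]: "a \<in> carrier B \<Longrightarrow> \<ominus> a \<oplus> a = \<zero>"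
  using additive.l_inv by (simp add: a_inv_def)

lemma add_neg [simp]: "a \<in> carrier B \<Longrightarrow> a \<oplus> \<ominus> a = \<zero>"
  using additive.r_inv by (simp add: a_inv_def)

lemma neg_add_cancel [simp]: "\<lbrakk>a \<in> carrier B; b \<in> carrier B\<rbrakk> \<Longrightarrow> \<ominus> a \<oplus> (a \<oplus> b) = b"
  by (simp flip: add_assoc)

lemma add_neg_cancel [simp]: "\<lbrakk>a \<in> carrier B; b \<in> carrier B\<rbrakk> \<Longrightarrow> a \<oplus> (\<ominus> a \<oplus> b) = b"
  by (simp flip: add_assoc)

lemma neg_neg [simp]: "a \<in> carrier B \<Longrightarrow> \<ominus> (\<ominus> a) = a"
  using additive.inv_inv by (simp add: a_inv_def)

lemma neg_zero [simp]: "\<ominus> \<zero> = \<zero>"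
  using additive.inv_one by (simp add: a_inv_def)

lemma neg_plus: "\<lbrakk>a \<in> carrier B; b \<in> carrier B\<rbrakk> \<Longrightarrow> \<ominus> (a \<oplus> b) = \<ominus> b \<oplus> \<ominus> a"
  using additive.inv_mult_group by (simp add: a_inv_def)

section \<open>The lambda action and the star operation\<close>

abbreviation lam :: "'a \<Rightarrow> 'a \<Rightarrow> 'a"
  where "lam \<equiv> brace_lambda B"

definition star :: "'a \<Rightarrow> 'a \<Rightarrow> 'a"
  where "star a b = \<ominus> a \<oplus> a \<otimes> b \<oplus> \<ominus> b"

lemma lam_closed [simp]: "\<lbrakk>a \<in> carrier B; b \<in> carrier B\<rbrakk> \<Longrightarrow> lam a b \<in> carrier B"
  by (simp add: brace_lambda_def)

lemma star_closed [simp]: "\<lbrakk>a \<in> carrier B; b \<in> carrier B\<rbrakk> \<Longrightarrow> star a b \<in> carrier B"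
  by (simp add: star_def)

lemma mult_eq_lam: "\<lbrakk>a \<in> carrier B; b \<in> carrier B\<rbrakk> \<Longrightarrow> a \<otimes> b = a \<oplus> lam a b"
  by (simp add: brace_lambda_def)

lemma mult_eq_star: "\<lbrakk>a \<in> carrier B; b \<in> carrier B\<rbrakk> \<Longrightarrow> a \<otimes> b = a \<oplus> star a b \<oplus> b"
  by (simp add: star_def add_assoc)

lemma star_eq_lam: "star a b = lam a b \<oplus> \<ominus> b"
  by (simp add: star_def brace_lambda_def)

lemma lam_eq_star: "\<lbrakk>a \<in> carrier B; b \<in> carrier B\<rbrakk> \<Longrightarrow> lam a b = star a b \<oplus> b"
  by (simp add: star_eq_lam add_assoc)

lemma lam_add:
  "\<lbrakk>a \<in> carrier B; b \<in> carrier B; c \<in> carrier B\<rbrakk> \<Longrightarrow> lam a (b \<oplus> c) = lam a b \<oplus> lam a c"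
  by (simp add: brace_lambda_def left_brace add_assoc)

lemma group_hom_lam: "a \<in> carrier B \<Longrightarrow> group_hom (add_monoid B) (add_monoid B) (lam a)"
  unfolding group_hom_def group_hom_axioms_def
  using additive.group_axioms by (simp add: hom_def lam_add)

lemma lam_neg: "\<lbrakk>a \<in> carrier B; b \<in> carrier B\<rbrakk> \<Longrightarrow> lam a (\<ominus> b) = \<ominus> lam a b"
  using group_hom.hom_inv[OF group_hom_lam] by (simp add: a_inv_def)

text \<open>Applying the additive map \<open>lam a\<close> to
  \<open>b \<otimes> c = b \<oplus> lam b c\<close> and cancelling \<open>lam a b\<close> shows that
  \<open>lam\<close> is an action of the multiplicative group.\<close>

lemma lam_mult:
  assumes "a \<in> carrier B" "b \<in> carrier B" "c \<in> carrier B"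
  shows "lam (a \<otimes> b) c = lam a (lam b c)"
proof -
  have "lam a b \<oplus> lam a (lam b c) = lam a (b \<otimes> c)"
    using assms by (simp add: mult_eq_lam flip: lam_add)
  then have "\<ominus> lam a b \<oplus> (lam a b \<oplus> lam a (lam b c)) = \<ominus> lam a b \<oplus> lam a (b \<otimes> c)"
    by simp
  then have "lam a (lam b c) = \<ominus> lam a b \<oplus> lam a (b \<otimes> c)"
    using assms by simp
  then show ?thesis
    using assms by (simp add: brace_lambda_def neg_plus add_assoc m_assoc)
qed

lemma lam_zero [simp]:
  assumes "a \<in> carrier B"
  shows "lam \<zero> a = a"
proof -
  have "\<zero> \<otimes> a = a" using l_one[OF assms] unfolding one_eq_zero .
  then show ?thesis unfolding brace_lambda_def using assms by (simp only: neg_zero zero_add)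
qed

lemma lam_inv_lam [simp]: "\<lbrakk>a \<in> carrier B; b \<in> carrier B\<rbrakk> \<Longrightarrow> lam (inv a) (lam a b) = b"
  by (simp add: one_eq_zero flip: lam_mult)

lemma lam_lam_inv [simp]: "\<lbrakk>a \<in> carrier B; b \<in> carrier B\<rbrakk> \<Longrightarrow> lam a (lam (inv a) b) = b"
  by (simp add: one_eq_zero flip: lam_mult)

text \<open>A star is sent to a difference of two stars with the same right argument. Both later
  invariance proofs under \<open>lam\<close>, for the centralizer of the stars and for the subgroup
  \<open>T\<close>, rest on this.\<close>

lemma lam_star:
  "\<lbrakk>a \<in> carrier B; b \<in> carrier B; c \<in> carrier B\<rbrakk> \<Longrightarrow>
    lam a (star b c) = star (a \<otimes> b) c \<oplus> \<ominus> star a c"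
  by (simp add: star_eq_lam lam_add lam_neg lam_mult neg_plus add_assoc)

text \<open>Additivity of \<open>lam a\<close> on \<open>g \<oplus> b\<close> puts conjugates of
  stars into the additive subgroup generated by the stars.\<close>

lemma star_conj:
  "\<lbrakk>a \<in> carrier B; b \<in> carrier B; g \<in> carrier B\<rbrakk> \<Longrightarrow>
    g \<oplus> star a b \<oplus> \<ominus> g = \<ominus> star a g \<oplus> star a (g \<oplus> b)"
  by (simp add: star_eq_lam lam_add neg_plus add_assoc)

text \<open>\<open>M\<close> is the kernel of a map \<open>p\<close> to an abelian group. Since
  \<open>p\<close> kills the stars it is also multiplicative, so \<open>M\<close> is normal in both
  groups and contains both kinds of commutators; invariance follows from
  \<open>lam b m = star b m \<oplus> m\<close>.\<close>

lemma commutator_brace_ideal_subset: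
  assumes M: "subgroup M (add_monoid B)"
    and D: "\<And>x y. \<lbrakk>x \<in> carrier B; y \<in> carrier B\<rbrakk> \<Longrightarrow> x \<oplus> y \<oplus> \<ominus> x \<oplus> \<ominus> y \<in> M"
    and S: "\<And>x y. \<lbrakk>x \<in> carrier B; y \<in> carrier B\<rbrakk> \<Longrightarrow> star x y \<in> M"
  shows "commutator_brace_ideal B \<subseteq> M"
proof -
  obtain Q :: "'a set monoid" and p
    where nM: "M \<lhd> add_monoid B" and Q: "comm_group Q" and ph: "p \<in> hom (add_monoid B) Q"
      and pM': "\<And>x. x \<in> carrier (add_monoid B) \<Longrightarrow> p x = \<one>\<^bsub>Q\<^esub> \<longleftrightarrow> x \<in> M"
    using additive.abelian_quotient[OF M] D by (auto simp: a_inv_def)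
  interpret Q: comm_group Q by (rule Q)
  interpret M: normal M "add_monoid B" by (rule nM)
  interpret p: group_hom "add_monoid B" Q p
    unfolding group_hom_def group_hom_axioms_def
    using additive.group_axioms Q.group_axioms ph by blast
  have pM: "p x = \<one>\<^bsub>Q\<^esub> \<longleftrightarrow> x \<in> M" if "x \<in> carrier B" for x
    using that pM' by simp
  have pmult: "p (a \<otimes> b) = p a \<otimes>\<^bsub>Q\<^esub> p b" if "a \<in> carrier B" "b \<in> carrier B" for a b
  proof -
    have "p (star a b) = \<one>\<^bsub>Q\<^esub>" using that S pM by simp
    then show ?thesis
      using that p.hom_mult p.hom_closed by (simp add: mult_eq_star)
  qed
  have phom: "p \<in> hom B Q" using p.hom_closed pmult by (simp add: hom_def)
  then interpret mp: group_hom B Q p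
    unfolding group_hom_def group_hom_axioms_def
    using group_axioms Q.group_axioms by blast
  have "kernel B Q p = M"
    using pM M.subset by (auto simp: kernel_def)
  then have nM': "M \<lhd> B" using mp.normal_kernel by simp
  have "brace_lambda B b m \<in> M" if "b \<in> carrier B" "m \<in> M" for b m
    using that S[of b m] M.mem_carrier[of m] M.m_closed by (simp add: lam_eq_star)
  then have ideal: "brace_ideal M B"
    using nM nM' by (auto simp: brace_ideal_def)
  have "derived_set (add_monoid B) (carrier B) \<subseteq> M"
    using D by (auto simp: a_inv_def)
  moreover have "derived_set B (carrier B) \<subseteq> M"
    using hom_commutator_trivial[OF phom Q.group_axioms] mp.hom_closed
    by (auto simp: Q.m_comm simp flip: pM)
  \<comment> \<open>The element is \<open>a \<oplus> star a b \<oplus> \<ominus> a\<close>, a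
    conjugate of a star.\<close>
  moreover have "a \<otimes> b \<oplus> \<ominus> (a \<oplus> b) \<in> M" if "a \<in> carrier B" "b \<in> carrier B" for a b
    using that M.inv_op_closed2[of a "star a b"] S
    by (simp add: mult_eq_star neg_plus add_assoc flip: a_inv_def)
  ultimately show ?thesis
    using ideal unfolding commutator_brace_ideal_def gen_brace_ideal_def by blast
qed

text \<open>The commutator ideal is in particular a multiplicative subgroup containing all
  multiplicative commutators.\<close>

lemma perfect_mult_imp_perfect_brace:
  assumes "perfect_group B"
  shows "perfect_brace B"
proof -
  let ?S = "derived_set (add_monoid B) (carrier B) \<union> derived_set B (carrier B) \<union>
    {a \<otimes> b \<oplus> \<ominus> (a \<oplus> b) | a b. a \<in> carrier B \<and> b \<in> carrier B}"
  have "?S \<subseteq> carrier B" by (auto simp flip: a_inv_def)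
  then have "brace_ideal (commutator_brace_ideal B) B"
    unfolding commutator_brace_ideal_def by (rule brace_ideal_gen)
  then have I: "subgroup (commutator_brace_ideal B) B"
    by (auto simp: brace_ideal_def normal_imp_subgroup)
  have "carrier B \<subseteq> commutator_brace_ideal B"
    using assms I
    by (rule perfect_group_subset)
      (auto simp: commutator_brace_ideal_def gen_brace_ideal_def)
  then show ?thesis
    using subgroup.subset[OF I] by (auto simp: perfect_brace_def)
qed

end

section \<open>Two-sided skew braces\<close>

context two_sided_skew_brace
begin

text \<open>Right distributivity makes \<open>star _ c\<close> additive up to conjugation by
  \<open>b\<close>. It becomes a homomorphism when its values are central, or after mapping to an
  abelian group.\<close>

lemma star_add_left:
  assumes "a \<in> carrier B" "b \<in> carrier B" "c \<in> carrier B"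
  shows "star (a \<oplus> b) c = \<ominus> b \<oplus> star a c \<oplus> b \<oplus> star b c"
  using assms by (simp add: star_def right_brace neg_plus add_assoc)

text \<open>The automorphism \<open>lam a\<close> preserves central elements, so every
  \<open>star a z\<close> is central and the conjugation in \<open>star_add_left\<close> disappears.
  A perfect group has no nontrivial homomorphism with commuting values.\<close>

lemma lam_central:
  assumes perf: "perfect_group (add_monoid B)"
    and z: "z \<in> carrier B" "\<And>x. x \<in> carrier B \<Longrightarrow> x \<oplus> z = z \<oplus> x"
    and b: "b \<in> carrier B"
  shows "lam b z = z"
proof -
  have lamc: "x \<oplus> lam a z = lam a z \<oplus> x" if "a \<in> carrier B" "x \<in> carrier B" for a x
  proof -
    have "lam a (lam (inv a) x \<oplus> z) = lam a (z \<oplus> lam (inv a) x)"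
      using that z by simp
    then show ?thesis using that z(1) by (simp add: lam_add)
  qed
  have starc: "x \<oplus> star a z = star a z \<oplus> x" if "a \<in> carrier B" "x \<in> carrier B" for a x
  proof -
    have "x \<oplus> \<ominus> z = \<ominus> z \<oplus> (z \<oplus> x) \<oplus> \<ominus> z"
      using that z(1) by simp
    also have "\<dots> = \<ominus> z \<oplus> x"
      unfolding z(2)[OF that(2), symmetric] using that z(1) by (simp add: add_assoc)
    finally have neg: "x \<oplus> \<ominus> z = \<ominus> z \<oplus> x" .
    have "x \<oplus> star a z = lam a z \<oplus> x \<oplus> \<ominus> z"
      unfolding lamc[OF that, symmetric] using that z(1) by (simp add: star_eq_lam add_assoc)
    also have "\<dots> = star a z \<oplus> x"
      using that z(1) by (simp add: star_eq_lam add_assoc neg)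
    finally show ?thesis .
  qed
  have "(\<lambda>a. star a z) \<in> hom (add_monoid B) (add_monoid B)"
  proof (rule homI)
    fix x y assume xy: "x \<in> carrier (add_monoid B)" "y \<in> carrier (add_monoid B)"
    then have "\<ominus> y \<oplus> star x z \<oplus> y = star x z"
      using z(1) starc[of x y] by (simp add: add_assoc flip: starc)
    then show "star (x \<otimes>\<^bsub>add_monoid B\<^esub> y) z = star x z \<otimes>\<^bsub>add_monoid B\<^esub> star y z"
      using xy z(1) by (simp add: star_add_left)
  qed (use z(1) in simp)
  from perf this additive.group_axioms
  have "star b z = \<one>\<^bsub>add_monoid B\<^esub>"
    by (rule additive.perfect_hom_trivial) (use z b in \<open>auto intro: starc\<close>)
  then show ?thesis using z b by (simp add: lam_eq_star)
qed

lemma star_commute: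
  assumes "a \<in> carrier B" "b \<in> carrier B" "c \<in> carrier B" "d \<in> carrier B"
  shows "star a d \<oplus> (\<ominus> c \<oplus> b \<otimes> c \<oplus> \<ominus> b) = (\<ominus> c \<oplus> b \<otimes> c \<oplus> \<ominus> b) \<oplus> star a d"
proof -
  \<comment> \<open>Removing \<open>a \<otimes> c\<close> on the left and
    \<open>b \<otimes> d\<close> on the right leaves exactly the two elements in question, in one
    order for each expansion.\<close>
  let ?P = "\<ominus> (a \<otimes> c) \<oplus> (a \<oplus> b) \<otimes> (c \<oplus> d) \<oplus> \<ominus> (b \<otimes> d)"
  have expand: "(a \<oplus> b) \<otimes> (c \<oplus> d) = a \<otimes> (c \<oplus> d) \<oplus> \<ominus> (c \<oplus> d) \<oplus> b \<otimes> (c \<oplus> d)"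
    using assms by (intro right_brace) simp_all
  have expand': "(a \<oplus> b) \<otimes> (c \<oplus> d) = (a \<oplus> b) \<otimes> c \<oplus> \<ominus> (a \<oplus> b) \<oplus> (a \<oplus> b) \<otimes> d"
    using assms by (intro left_brace) simp_all
  have "?P = star a d \<oplus> (\<ominus> c \<oplus> b \<otimes> c \<oplus> \<ominus> b)"
    unfolding expand using assms by (simp add: star_def left_brace neg_plus add_assoc)
  moreover have "?P = (\<ominus> c \<oplus> b \<otimes> c \<oplus> \<ominus> b) \<oplus> star a d"
    unfolding expand' using assms by (simp add: star_def right_brace neg_plus add_assoc)
  ultimately show ?thesis by simp
qed

section \<open>The centralizer of the stars and its own centralizer\<close>

definition stars :: "'a set"
  where "stars = {star a b | a b. a \<in> carrier B \<and> b \<in> carrier B}"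

lemma stars_closed: "stars \<subseteq> carrier B"
  by (auto simp: stars_def)

text \<open>By \<open>star_conj\<close> the conjugate is a difference of stars. It need not be a
  star itself, but the double centralizer is a subgroup containing all stars.\<close>

lemma conj_star_double_centralizer:
  assumes "g \<in> carrier B" "s \<in> stars"
  shows "g \<oplus> s \<oplus> \<ominus> g \<in> additive.centralizer (additive.centralizer stars)" (is "_ \<in> ?N")
proof -
  obtain a b where s: "s = star a b" and ab: "a \<in> carrier B" "b \<in> carrier B"
    using assms by (auto simp: stars_def)
  have C: "additive.centralizer stars \<subseteq> carrier (add_monoid B)"
    by (auto simp: additive.centralizer_def)
  have "star a g \<in> stars" "star a (g \<oplus> b) \<in> stars"
    using assms(1) ab add_closed unfolding stars_def by blast+
  then have "star a g \<in> ?N" "star a (g \<oplus> b) \<in> ?N"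
    using additive.subset_double_centralizer[of stars] stars_closed by auto
  then show ?thesis
    unfolding s star_conj[OF ab assms(1)]
    using subgroup.m_closed[OF additive.subgroup_centralizer[OF C]]
      subgroup.m_inv_closed[OF additive.subgroup_centralizer[OF C]]
    by (simp add: a_inv_def)
qed

lemma normal_centralizer_stars: "additive.centralizer stars \<lhd> add_monoid B"
proof (rule additive.normal_centralizer)
  fix g s assume "g \<in> carrier (add_monoid B)" "s \<in> stars"
  then show "inv\<^bsub>add_monoid B\<^esub> g \<otimes>\<^bsub>add_monoid B\<^esub> s \<otimes>\<^bsub>add_monoid B\<^esub> g
      \<in> additive.centralizer (additive.centralizer stars)"
    using conj_star_double_centralizer[of "\<ominus> g" s] by (simp flip: a_inv_def)
qed (use stars_closed in simp)

lemma normal_double_centralizer_stars: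
  "additive.centralizer (additive.centralizer stars) \<lhd> add_monoid B" (is "?N \<lhd> _")
proof (rule additive.normal_centralizer)
  interpret C: normal "additive.centralizer stars" "add_monoid B"
    by (rule normal_centralizer_stars)
  show C: "additive.centralizer stars \<subseteq> carrier (add_monoid B)" by (rule C.subset)
  fix g s assume "g \<in> carrier (add_monoid B)" "s \<in> additive.centralizer stars"
  then have "inv\<^bsub>add_monoid B\<^esub> g \<otimes>\<^bsub>add_monoid B\<^esub> s \<otimes>\<^bsub>add_monoid B\<^esub> g \<in> additive.centralizer stars"
    by (rule C.inv_op_closed1)
  then show "inv\<^bsub>add_monoid B\<^esub> g \<otimes>\<^bsub>add_monoid B\<^esub> s \<otimes>\<^bsub>add_monoid B\<^esub> g
      \<in> additive.centralizer (additive.centralizer (additive.centralizer stars))"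
    using additive.subset_double_centralizer[OF C] by blast
qed

lemma star_double_centralizer:
  assumes "x \<in> carrier B" "y \<in> carrier B"
  shows "star x y \<in> additive.centralizer (additive.centralizer stars)"
proof -
  have "star x y \<in> stars" using assms by (auto simp: stars_def)
  then show ?thesis using additive.subset_double_centralizer[of stars] stars_closed by auto
qed

text \<open>This is \<open>star_commute\<close> read as a lower bound for the centralizer: it
  contains all stars of the opposite skew brace.\<close>

lemma op_star_centralizer:
  assumes "x \<in> carrier B" "y \<in> carrier B"
  shows "\<ominus> y \<oplus> x \<otimes> y \<oplus> \<ominus> x \<in> additive.centralizer stars"
  using assms star_commute by (auto simp: additive.centralizer_def stars_def)

lemma carrier_subset_centralizers:
  assumes "perfect_group (add_monoid B)"
  shows "carrier (add_monoid B) \<subseteq>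
    additive.centralizer (additive.centralizer stars) <#>\<^bsub>add_monoid B\<^esub> additive.centralizer stars"
    (is "_ \<subseteq> ?N <#>\<^bsub>_\<^esub> ?C")
proof (rule additive.perfect_group_subset[OF assms])
  interpret C: normal ?C "add_monoid B" by (rule normal_centralizer_stars)
  interpret N: normal ?N "add_monoid B" by (rule normal_double_centralizer_stars)
  show "subgroup (?N <#>\<^bsub>add_monoid B\<^esub> ?C) (add_monoid B)"
    using additive.mult_norm_subgroup[OF N.normal_axioms C.subgroup_axioms] .
  fix x y assume "x \<in> carrier (add_monoid B)" "y \<in> carrier (add_monoid B)"
  then have xy: "x \<in> carrier B" "y \<in> carrier B" by simp_all
  have "x \<oplus> \<ominus> star x y \<oplus> \<ominus> x \<in> ?N"
    using xy star_double_centralizer[OF xy] N.inv_op_closed2[of x "\<ominus> star x y"]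
      N.m_inv_closed[of "star x y"]
    by (simp flip: a_inv_def)
  moreover have "y \<oplus> (\<ominus> y \<oplus> x \<otimes> y \<oplus> \<ominus> x) \<oplus> \<ominus> y \<in> ?C"
    using xy op_star_centralizer[OF xy] C.inv_op_closed2[of y] by (simp flip: a_inv_def)
  \<comment> \<open>Inserts \<open>x \<otimes> y\<close> between \<open>x \<oplus> y\<close> and
    \<open>y \<oplus> x\<close>: the first factor is
    \<open>x \<oplus> y \<oplus> \<ominus> (x \<otimes> y)\<close>, the second
    \<open>x \<otimes> y \<oplus> \<ominus> x \<oplus> \<ominus> y\<close>.\<close>
  moreover have "x \<oplus> y \<oplus> \<ominus> x \<oplus> \<ominus> y =
    (x \<oplus> \<ominus> star x y \<oplus> \<ominus> x) \<oplus> (y \<oplus> (\<ominus> y \<oplus> x \<otimes> y \<oplus> \<ominus> x) \<oplus> \<ominus> y)"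
    using xy by (simp add: star_def neg_plus add_assoc)
  ultimately show "x \<otimes>\<^bsub>add_monoid B\<^esub> y \<otimes>\<^bsub>add_monoid B\<^esub> inv\<^bsub>add_monoid B\<^esub> x
      \<otimes>\<^bsub>add_monoid B\<^esub> inv\<^bsub>add_monoid B\<^esub> y \<in> ?N <#>\<^bsub>add_monoid B\<^esub> ?C"
    unfolding set_mult_def by (simp flip: a_inv_def) blast
qed

text \<open>The claim amounts to \<open>lam b c = c\<close>. The map \<open>lam b\<close> preserves
  the centralizer \<open>?C\<close>, so \<open>star b d\<close> lies in
  \<open>?N \<inter> ?C\<close> for \<open>d\<close> in \<open>?C\<close>; that intersection is
  central in the additive group, where \<open>lam_central\<close> applies.\<close>

lemma mult_eq_add_if_commutes_star:
  assumes perf: "perfect_group (add_monoid B)"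
    and c: "c \<in> additive.centralizer stars" and b: "b \<in> carrier B"
  shows "b \<otimes> c = b \<oplus> c"
proof -
  let ?C = "additive.centralizer stars"
  let ?N = "additive.centralizer ?C"
  interpret C: normal ?C "add_monoid B" by (rule normal_centralizer_stars)
  interpret N: normal ?N "add_monoid B" by (rule normal_double_centralizer_stars)
  have CB: "x \<in> carrier B" if "x \<in> ?C" for x using C.subset that by auto
  have comm: "x \<oplus> n = n \<oplus> x" if "n \<in> ?N" "x \<in> ?C" for n x
    using that unfolding additive.centralizer_def[of ?C] by simp
  note prod = carrier_subset_centralizers[OF perf]
  have "lam b c = c"
  proof (rule additive.perfect_central_product_hom
      [OF perf N.subgroup_axioms C.subgroup_axioms _ _ prod _ _ c])
    show "lam b \<in> hom (add_monoid B) (add_monoid B)"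
      using group_hom.homh[OF group_hom_lam[OF b]] .
    show "x \<otimes>\<^bsub>add_monoid B\<^esub> n = n \<otimes>\<^bsub>add_monoid B\<^esub> x" if "n \<in> ?N" "x \<in> ?C" for n x
      using comm[OF that] by simp
    show "lam b z = z" if z: "z \<in> ?N \<inter> ?C" for z
    proof (rule lam_central[OF perf _ _ b])
      show "z \<in> carrier B" using z CB by blast
      fix x assume "x \<in> carrier B"
      then have "x \<in> ?N <#>\<^bsub>add_monoid B\<^esub> ?C" using prod by auto
      then obtain n d where *: "n \<in> ?N" "d \<in> ?C" "x = n \<oplus> d"
        unfolding set_mult_def by auto
      have mem: "n \<in> carrier B" "d \<in> carrier B" "z \<in> carrier B"
        using * z CB N.mem_carrier by auto
      have "x \<oplus> z = n \<oplus> (d \<oplus> z)" using * mem by (simp add: add_assoc)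
      also have "\<dots> = (n \<oplus> z) \<oplus> d" using comm[of z d] * z mem by (simp add: add_assoc)
      also have "n \<oplus> z = z \<oplus> n" using comm[of n z] * z by simp
      finally show "x \<oplus> z = z \<oplus> x" using * mem by (simp add: add_assoc)
    qed
    fix d assume d: "d \<in> ?C"
    have "lam b d \<oplus> s = s \<oplus> lam b d" if sS: "s \<in> stars" for s
    proof -
      obtain x y where s: "s = star x y" "x \<in> carrier B" "y \<in> carrier B"
        using sS by (auto simp: stars_def)
      \<comment> \<open>By \<open>lam_star\<close> this element is \<open>lam (inv b) s\<close>. It
        commutes with \<open>d\<close> because it lies in \<open>?N\<close>, and applying
        \<open>lam b\<close> carries the relation back to \<open>s\<close>.\<close>
      have "star (inv b \<otimes> x) y \<oplus> \<ominus> star (inv b) y \<in> ?N"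
        using star_double_centralizer[of "inv b \<otimes> x" y] N.m_inv_closed[OF star_double_centralizer[of "inv b" y]] N.m_closed b s
        by (simp add: a_inv_def)
      then have "lam b (d \<oplus> lam (inv b) s) = lam b (lam (inv b) s \<oplus> d)"
        using comm[OF _ d] b s by (simp add: lam_star)
      then show ?thesis using b d CB s by (simp add: lam_add)
    qed
    then have "lam b d \<in> ?C" using b CB[OF d] unfolding additive.centralizer_def by simp
    then have "star b d \<in> ?C"
      using C.m_closed C.m_inv_closed[OF d] by (simp add: star_eq_lam a_inv_def)
    then show "lam b d \<otimes>\<^bsub>add_monoid B\<^esub> inv\<^bsub>add_monoid B\<^esub> d \<in> ?N \<inter> ?C"
      using star_double_centralizer b d CB by (simp add: star_eq_lam flip: a_inv_def)
  qed
  then show ?thesis using b c CB by (simp add: mult_eq_lam)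
qed

section \<open>The opposite skew brace\<close>

definition op_brace :: "('a, 'b) ring_scheme"
  where "op_brace = B\<lparr>add := \<lambda>x y. y \<oplus> x\<rparr>"

lemma op_brace_simps [simp]:
  "carrier op_brace = carrier B" "x \<oplus>\<^bsub>op_brace\<^esub> y = y \<oplus> x" "\<zero>\<^bsub>op_brace\<^esub> = \<zero>"
  "x \<otimes>\<^bsub>op_brace\<^esub> y = x \<otimes> y" "\<one>\<^bsub>op_brace\<^esub> = \<one>"
  by (simp_all add: op_brace_def)

lemma group_op_brace: "group (add_monoid op_brace)"
proof (rule groupI)
  fix x assume "x \<in> carrier (add_monoid op_brace)"
  then show "\<exists>y \<in> carrier (add_monoid op_brace).
      y \<otimes>\<^bsub>add_monoid op_brace\<^esub> x = \<one>\<^bsub>add_monoid op_brace\<^esub>"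
    by (intro bexI[of _ "\<ominus> x"]) simp_all
qed (simp_all add: add_assoc)

lemma neg_op_brace [simp]:
  assumes "x \<in> carrier B"
  shows "a_inv op_brace x = \<ominus> x"
  unfolding a_inv_def[of op_brace]
  using assms by (intro group.inv_equality[OF group_op_brace]) simp_all

text \<open>Reversing addition turns each brace axiom into itself with the two summands exchanged,
  so results about \<open>B\<close> can be dualized.\<close>

lemma two_sided_skew_brace_op: "two_sided_skew_brace op_brace"
proof -
  have "group op_brace"
    by (rule groupI) (auto simp: m_assoc intro: l_inv_ex)
  then show ?thesis
    using group_op_brace
    by (intro two_sided_skew_brace.intro skew_brace.intro skew_brace_axioms.intro
        two_sided_skew_brace_axioms.intro)
      (simp_all add: left_brace right_brace add_assoc)
qed

lemma perfect_group_op_brace: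
  assumes "perfect_group (add_monoid B)"
  shows "perfect_group (add_monoid op_brace)"
proof -
  interpret op: two_sided_skew_brace op_brace by (rule two_sided_skew_brace_op)
  let ?D = "derived (add_monoid op_brace) (carrier op_brace)"
  have D: "subgroup ?D (add_monoid op_brace)"
    using op.additive.derived_is_subgroup[of "carrier B"] by simp
  have neg: "\<ominus> x \<in> ?D" if "x \<in> ?D" for x
  proof -
    have "a_inv op_brace x \<in> ?D" using subgroup.m_inv_closed[OF D that] by (simp only: a_inv_def)
    moreover have "x \<in> carrier B" using subgroup.mem_carrier[OF D that] by simp
    ultimately show ?thesis by (simp only: neg_op_brace)
  qed
  have "carrier (add_monoid B) \<subseteq> ?D"
  proof (rule additive.perfect_group_subset[OF assms])
    show "subgroup ?D (add_monoid B)"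
      using subgroup.subset[OF D] subgroup.m_closed[OF D] subgroup.one_closed[OF D] neg
      by (intro additive.subgroupI) (auto simp flip: a_inv_def)
    fix x y assume "x \<in> carrier (add_monoid B)" "y \<in> carrier (add_monoid B)"
    \<comment> \<open>The commutator of \<open>x\<close> and \<open>y\<close> is the opposite
      commutator of \<open>\<ominus> y\<close> and \<open>\<ominus> x\<close>.\<close>
    then have "\<ominus> y \<in> carrier B" "\<ominus> x \<in> carrier B" "x \<oplus> y \<oplus> \<ominus> x \<oplus> \<ominus> y =
      \<ominus> y \<oplus>\<^bsub>op_brace\<^esub> \<ominus> x \<oplus>\<^bsub>op_brace\<^esub> a_inv op_brace (\<ominus> y) \<oplus>\<^bsub>op_brace\<^esub> a_inv op_brace (\<ominus> x)"
      by (simp_all add: add_assoc)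
    then have "x \<oplus> y \<oplus> \<ominus> x \<oplus> \<ominus> y \<in> derived_set (add_monoid op_brace) (carrier op_brace)"
      by (auto simp: a_inv_def[of op_brace])
    then show "x \<otimes>\<^bsub>add_monoid B\<^esub> y \<otimes>\<^bsub>add_monoid B\<^esub> inv\<^bsub>add_monoid B\<^esub> x
        \<otimes>\<^bsub>add_monoid B\<^esub> inv\<^bsub>add_monoid B\<^esub> y \<in> ?D"
      by (auto simp: derived_def a_inv_def intro: generate.incl)
  qed
  then show ?thesis
    using subgroup.subset[OF D] by (auto simp: perfect_group_def)
qed

text \<open>Dual of \<open>mult_eq_add_if_commutes_star\<close>: the stars of
  \<open>op_brace\<close> lie in the centralizer of \<open>stars\<close>, so \<open>n\<close>
  commutes with all of them. The reversed order of the sum comes from the opposite addition.\<close>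

lemma mult_eq_add_if_double_centralizer:
  assumes perf: "perfect_group (add_monoid B)"
    and n: "n \<in> additive.centralizer (additive.centralizer stars)" and b: "b \<in> carrier B"
  shows "b \<otimes> n = n \<oplus> b"
proof -
  interpret op: two_sided_skew_brace op_brace by (rule two_sided_skew_brace_op)
  have "n \<oplus> s = s \<oplus> n" if sS: "s \<in> op.stars" for s
  proof -
    obtain x y where xy: "s = op.star x y" "x \<in> carrier B" "y \<in> carrier B"
      using sS by (auto simp: op.stars_def)
    then have "s = \<ominus> y \<oplus> x \<otimes> y \<oplus> \<ominus> x"
      by (simp add: op.star_def add_assoc)
    then show ?thesis
      using n op_star_centralizer[OF xy(2,3)] unfolding additive.centralizer_def[of "additive.centralizer _"]
      by simp
  qed
  then have "n \<in> op.additive.centralizer op.stars"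
    using n unfolding op.additive.centralizer_def additive.centralizer_def by simp
  then show ?thesis
    using op.mult_eq_add_if_commutes_star[OF perfect_group_op_brace[OF perf]] b by simp
qed

text \<open>With \<open>p\<close> the abelianization map of the multiplicative group, splitting both
  summands along the central product shows that \<open>p\<close> is additive as well; additive
  perfectness then makes it trivial.\<close>

lemma perfect_add_imp_perfect_mult:
  assumes perf: "perfect_group (add_monoid B)"
  shows "perfect_group B"
proof -
  let ?C = "additive.centralizer stars"
  let ?N = "additive.centralizer ?C"
  let ?D = "derived B (carrier B)"
  interpret C: normal ?C "add_monoid B" by (rule normal_centralizer_stars)
  interpret N: normal ?N "add_monoid B" by (rule normal_double_centralizer_stars)
  have D: "subgroup ?D B" by (rule derived_is_subgroup) simp
  obtain Q :: "'a set monoid" and p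
    where Q: "comm_group Q" and ph: "p \<in> hom B Q"
      and pD: "\<And>x. x \<in> carrier B \<Longrightarrow> p x = \<one>\<^bsub>Q\<^esub> \<longleftrightarrow> x \<in> ?D"
    by (rule abelian_quotient[OF D]) (auto simp: derived_def intro: generate.incl)
  interpret Q: comm_group Q by (rule Q)
  interpret p: group_hom B Q p
    unfolding group_hom_def group_hom_axioms_def
    using group_axioms Q.group_axioms ph by blast
  have "p (x \<oplus> y) = p x \<otimes>\<^bsub>Q\<^esub> p y" if "x \<in> carrier B" "y \<in> carrier B" for x y
  proof -
    have "x \<in> ?N <#>\<^bsub>add_monoid B\<^esub> ?C" "y \<in> ?N <#>\<^bsub>add_monoid B\<^esub> ?C"
      using that carrier_subset_centralizers[OF perf] by auto
    then obtain n c m d where *: "n \<in> ?N" "c \<in> ?C" "x = n \<oplus> c" "m \<in> ?N" "d \<in> ?C" "y = m \<oplus> d"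
      unfolding set_mult_def by auto
    have mem: "n \<in> carrier B" "c \<in> carrier B" "m \<in> carrier B" "d \<in> carrier B"
      using * N.mem_carrier C.mem_carrier by auto
    have multC: "b \<otimes> e = b \<oplus> e" if "e \<in> ?C" "b \<in> carrier B" for b e
      using that by (rule mult_eq_add_if_commutes_star[OF perf])
    have cm: "c \<oplus> m = m \<oplus> c"
      using *(2,4) unfolding additive.centralizer_def[of ?C] by simp
    have "x \<oplus> y = n \<oplus> (c \<oplus> m) \<oplus> d"
      using mem by (simp add: * add_assoc)
    also have "\<dots> = (n \<oplus> m) \<oplus> (c \<oplus> d)"
      unfolding cm using mem by (simp add: add_assoc)
    also have "\<dots> = (n \<oplus> m) \<otimes> (c \<oplus> d)"
      using * mem C.m_closed[of c d] by (simp add: multC)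
    \<comment> \<open>The factors \<open>m\<close> and \<open>n\<close> change places because
      multiplying by an element of \<open>?N\<close> adds it on the left; \<open>p\<close> does not
      see this order.\<close>
    also have "\<dots> = (m \<otimes> n) \<otimes> (c \<otimes> d)"
      using * mem by (simp add: multC mult_eq_add_if_double_centralizer[OF perf])
    also have "p \<dots> = p (n \<otimes> c) \<otimes>\<^bsub>Q\<^esub> p (m \<otimes> d)"
      using mem by (simp add: Q.m_ac)
    also have "\<dots> = p x \<otimes>\<^bsub>Q\<^esub> p y"
      using * mem by (simp only: multC)
    finally show ?thesis .
  qed
  then have "p \<in> hom (add_monoid B) Q" by (simp add: hom_def)
  then have "p x = \<one>\<^bsub>Q\<^esub>" if "x \<in> carrier B" for x
    by (rule additive.perfect_hom_trivial[OF perf _ Q.group_axioms])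
      (use that in \<open>auto simp: Q.m_comm\<close>)
  then show ?thesis
    using pD subgroup.subset[OF D] by (auto simp: perfect_group_def)
qed

section \<open>A Nakayama argument for finite skew braces\<close>

lemma perfect_brace_imp_perfect_add:
  assumes "perfect_brace B" "finite (carrier B)"
  shows "perfect_group (add_monoid B)"
proof (rule ccontr)
  let ?D = "derived (add_monoid B) (carrier B)"
  assume "\<not> perfect_group (add_monoid B)"
  then have neq: "?D \<noteq> carrier B" by (auto simp: perfect_group_def)
  define F where "F = {M. subgroup M (add_monoid B) \<and> ?D \<subseteq> M \<and>
    (\<forall>a \<in> carrier B. \<forall>m \<in> M. lam a m \<in> M) \<and> M \<noteq> carrier B}"
  \<comment> \<open>Each \<open>lam a\<close> is an additive endomorphism and so preserves the
    derived subgroup; hence \<open>F\<close> is nonempty.\<close>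
  have "lam a m \<in> ?D" if "a \<in> carrier B" "m \<in> ?D" for a m
  proof -
    interpret l: group_hom "add_monoid B" "add_monoid B" "lam a"
      using that by (intro group_hom_lam)
    have "lam a ` ?D = derived (add_monoid B) (lam a ` carrier B)"
      using l.derived_img[of "carrier B"] by simp
    also have "\<dots> \<subseteq> ?D"
      using that by (intro additive.mono_derived) auto
    finally show ?thesis using that by blast
  qed
  then have "?D \<in> F"
    using neq additive.derived_is_subgroup[of "carrier B"] by (simp add: F_def)
  moreover have "finite F"
  proof (rule finite_subset)
    have "M \<subseteq> carrier B" if "subgroup M (add_monoid B)" for M
      using subgroup.subset[OF that] by simp
    then show "F \<subseteq> Pow (carrier B)" unfolding F_def by blast
  qed (use assms in simp)
  ultimately obtain M where MF: "M \<in> F" and max: "\<And>T. \<lbrakk>T \<in> F; M \<subseteq> T\<rbrakk> \<Longrightarrow> M = T"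
    using finite_has_maximal[of F] by blast
  from MF have M: "subgroup M (add_monoid B)" and DM: "?D \<subseteq> M"
    and lamM: "\<And>a m. \<lbrakk>a \<in> carrier B; m \<in> M\<rbrakk> \<Longrightarrow> lam a m \<in> M" and MB: "M \<noteq> carrier B"
    by (auto simp: F_def)
  have com: "x \<oplus> y \<oplus> \<ominus> x \<oplus> \<ominus> y \<in> M" if "x \<in> carrier B" "y \<in> carrier B" for x y
  proof -
    have "x \<oplus> y \<oplus> \<ominus> x \<oplus> \<ominus> y \<in> derived_set (add_monoid B) (carrier B)"
      using that by (auto simp: a_inv_def)
    then show ?thesis using DM by (auto simp: derived_def intro: generate.incl)
  qed
  obtain Q :: "'a set monoid" and p
    where nM: "M \<lhd> add_monoid B" and Q: "comm_group Q" and ph: "p \<in> hom (add_monoid B) Q"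
      and pM': "\<And>x. x \<in> carrier (add_monoid B) \<Longrightarrow> p x = \<one>\<^bsub>Q\<^esub> \<longleftrightarrow> x \<in> M"
    using additive.abelian_quotient[OF M] com by (auto simp: a_inv_def)
  interpret Q: comm_group Q by (rule Q)
  interpret M: normal M "add_monoid B" by (rule nM)
  interpret p: group_hom "add_monoid B" Q p
    unfolding group_hom_def group_hom_axioms_def
    using additive.group_axioms Q.group_axioms ph by blast
  have pc: "p x \<in> carrier Q" if "x \<in> carrier B" for x
    using that p.hom_closed by simp
  have padd: "p (x \<oplus> y) = p x \<otimes>\<^bsub>Q\<^esub> p y" if "x \<in> carrier B" "y \<in> carrier B" for x y
    using that p.hom_mult by simp
  have pneg: "p (\<ominus> x) = inv\<^bsub>Q\<^esub> p x" if "x \<in> carrier B" for x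
    using that p.hom_inv by (simp add: a_inv_def)
  have pM: "p x = \<one>\<^bsub>Q\<^esub> \<longleftrightarrow> x \<in> M" if "x \<in> carrier B" for x
    using that pM' by simp
  have peq: "p x = p y \<longleftrightarrow> x \<oplus> \<ominus> y \<in> M" if "x \<in> carrier B" "y \<in> carrier B" for x y
    using that Q.inv_solve_right'[of "\<one>\<^bsub>Q\<^esub>" "p x" "p y"] pc
    by (simp add: padd pneg flip: pM)
  have "star a x \<in> M" if x: "x \<in> carrier B" and a: "a \<in> carrier B" for a x
  proof (cases "x \<in> M")
    case True
    then show ?thesis
      using lamM[OF a] M.m_inv_closed[of x] M.m_closed by (simp add: star_eq_lam a_inv_def)
  next
    case False
    define h where "h b = p (star b x)" for b
    \<comment> \<open>The preimage under \<open>p\<close> of the image of \<open>h\<close>, that is,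
      \<open>M\<close> enlarged by all \<open>star b x\<close> for the fixed
      \<open>x\<close>.\<close>
    define T where "T = {y \<in> carrier B. \<exists>b \<in> carrier B. p y = h b}"
    \<comment> \<open>The conjugation in \<open>star_add_left\<close> vanishes in the abelian group
      \<open>Q\<close>.\<close>
    interpret h: group_hom "add_monoid B" Q h
    proof (unfold_locales, rule homI)
      fix b c assume bc: "b \<in> carrier (add_monoid B)" "c \<in> carrier (add_monoid B)"
      then show "h (b \<otimes>\<^bsub>add_monoid B\<^esub> c) = h b \<otimes>\<^bsub>Q\<^esub> h c"
        using x pc by (simp add: h_def star_add_left padd pneg Q.m_comm[of _ "p c"] flip: Q.m_assoc)
    qed (use x pc in \<open>simp add: h_def\<close>)
    have hadd: "h (b \<oplus> c) = h b \<otimes>\<^bsub>Q\<^esub> h c" if "b \<in> carrier B" "c \<in> carrier B" for b c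
      using that h.hom_mult by simp
    have hneg: "h (\<ominus> b) = inv\<^bsub>Q\<^esub> h b" if "b \<in> carrier B" for b
      using that h.hom_inv by (simp add: a_inv_def)
    have MT: "M \<subseteq> T"
    proof
      fix m assume m: "m \<in> M"
      then have "m \<in> carrier B" using M.mem_carrier by simp
      moreover have "h \<zero> = \<one>\<^bsub>Q\<^esub>" using h.hom_one by simp
      ultimately show "m \<in> T" using m pM by (auto simp: T_def intro!: bexI[of _ \<zero>])
    qed
    \<comment> \<open>If \<open>x\<close> is congruent to \<open>star b x\<close> modulo
      \<open>M\<close>, then \<open>lam (\<ominus> b) x\<close> lies in \<open>M\<close>. Acting
      with the multiplicative inverse of \<open>\<ominus> b\<close> would put \<open>x\<close>
      itself into \<open>M\<close>.\<close>
    have "T \<noteq> carrier B"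
    proof
      assume "T = carrier B"
      then obtain b where b: "b \<in> carrier B" "p x = h b" using x by (auto simp: T_def)
      have "p (lam (\<ominus> b) x) = h (\<ominus> b) \<otimes>\<^bsub>Q\<^esub> p x"
        using b(1) x by (simp add: lam_eq_star padd h_def)
      also have "\<dots> = \<one>\<^bsub>Q\<^esub>"
        using b x pc by (simp add: hneg flip: b(2))
      finally have "lam (\<ominus> b) x \<in> M" using pM b(1) x by simp
      then have "lam (inv (\<ominus> b)) (lam (\<ominus> b) x) \<in> M" using b(1) lamM[of "inv (\<ominus> b)"] by simp
      then show False using False b(1) x by simp
    qed
    moreover have "subgroup T (add_monoid B)"
    proof (rule additive.subgroupI)
      show "T \<noteq> {}" using MT M.one_closed by auto
    next
      fix y assume "y \<in> T"
      then obtain b where b: "y \<in> carrier B" "b \<in> carrier B" "p y = h b" by (auto simp: T_def)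
      then have "p (\<ominus> y) = h (\<ominus> b)" by (simp add: pneg hneg)
      then show "inv\<^bsub>add_monoid B\<^esub> y \<in> T"
        using b(1,2) by (auto simp: T_def simp flip: a_inv_def)
    next
      fix y z assume "y \<in> T" "z \<in> T"
      then obtain b c where b: "y \<in> carrier B" "b \<in> carrier B" "p y = h b"
        "z \<in> carrier B" "c \<in> carrier B" "p z = h c" by (auto simp: T_def)
      then have "p (y \<oplus> z) = h (b \<oplus> c)" by (simp add: padd hadd)
      then show "y \<otimes>\<^bsub>add_monoid B\<^esub> z \<in> T"
        using b(1,2,4,5) by (auto simp: T_def)
    qed (auto simp: T_def)
    moreover have "lam c y \<in> T" if c: "c \<in> carrier B" and y: "y \<in> T" for c y
    proof -
      obtain b where b: "y \<in> carrier B" "b \<in> carrier B" "p y = p (star b x)"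
        using y by (auto simp: T_def h_def)
      have "lam c (y \<oplus> \<ominus> star b x) \<in> M"
        using b x c peq by (intro lamM) simp_all
      then have "p (lam c y) = p (lam c (star b x))"
        using b(1,2) x c by (simp add: peq lam_add lam_neg)
      \<comment> \<open>By \<open>lam_star\<close> the image is
        \<open>star (c \<otimes> b) x \<oplus> \<ominus> star c x\<close>; additivity of
        \<open>h\<close> merges the two terms into the witness
        \<open>c \<otimes> b \<oplus> \<ominus> c\<close>.\<close>
      also have "\<dots> = h (c \<otimes> b \<oplus> \<ominus> c)"
        using b(1,2) x c by (simp add: lam_star padd pneg hadd hneg) (simp add: h_def)
      finally show ?thesis using b(1,2) c by (auto simp: T_def)
    qed
    ultimately have "T \<in> F" using DM MT by (auto simp: F_def)
    \<comment> \<open>Each \<open>star a x\<close> lies in \<open>T\<close> with \<open>a\<close> as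
      its witness, so maximality places it in \<open>M\<close>.\<close>
    then have "M = T" using max MT by blast
    then show ?thesis using a x by (auto simp: T_def h_def)
  qed
  then have "commutator_brace_ideal B \<subseteq> M"
    using commutator_brace_ideal_subset[OF M com] by blast
  then show False
    using assms(1) MB M.subset by (auto simp: perfect_brace_def)
qed

end

theorem corollary1:
  fixes B :: "('a, 'b) ring_scheme"
  assumes "two_sided_skew_brace B"
    and "finite (carrier B)"
  shows "(perfect_brace B \<longleftrightarrow> perfect_group (add_monoid B)) \<and>
         (perfect_group (add_monoid B) \<longleftrightarrow> perfect_group B)"
proof -
  interpret two_sided_skew_brace B by fact
  show ?thesis
    using perfect_brace_imp_perfect_add[OF _ assms(2)] perfect_add_imp_perfect_mult
      perfect_mult_imp_perfect_brace by blast
qed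

end
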